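(* Let $(X,d,\mu)$ be a space of homogeneous type. There exists a constant $\Lambda$, depending only on the space $(X,d,\mu)$, such that the following holds. For every bounded subset $G$ of $X$ and every $\rho>0$ there exists a finite covering $\{B(x_i,r_i): i=1,\dots,I_\rho\}$ of $G$ by $d$-balls with $x_i\in G$ and $\mu(B(x_i,r_i))<\rho$ for every $i$, and such that each $y\in X$ belongs to at most $\Lambda$ of these balls.
   Context: A quasi-metric on a set $X$ is a function $d:X\times X\to[0,\infty)$ with $d(x,y)=0$ iff $x=y$, $d(x,y)=d(y,x)$, and $d(x,y)\le K(d(x,z)+d(z,y))$ for all $x,y,z\in X$, for some constant $K\ge 1$. Write $B(x,r)=\{y\in X: d(x,y)<r\}$, $r>0$, for the $d$-balls. The topology on $X$ is the one induced by $d$: its neighborhood system is given by the sets containing a $d$-ball; it is assumed that the $d$-balls are open sets. A set $G\subseteq X$ is bounded if $\mathrm{diam}(G)=\sup\{d(x,y):x,y\in G\}<\infty$. A Borel measure $\mu$ is doubling if there is a constant $A\ge 1$ with $0<\mu(B(x,2r))\le A\mu(B(x,r))<\infty$ for all $x\in X$, $r>0$; it is non-atomic if $\mu(\{x\})=0$ for all $x\in X$. $(X,d,\mu)$ is a space of homogeneous type if $\mu$ is a non-atomic doubling measure on the quasi-metric space $(X,d)$. *)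

theory Defs
  imports "HOL-Analysis.Analysis"
begin

definition quasi_metric_on :: "'a set \<Rightarrow> ('a \<Rightarrow> 'a \<Rightarrow> real) \<Rightarrow> bool" where
  "quasi_metric_on X d \<longleftrightarrow>
     (\<forall>x\<in>X. \<forall>y\<in>X. 0 \<le> d x y) \<and>
     (\<forall>x\<in>X. \<forall>y\<in>X. d x y = 0 \<longleftrightarrow> x = y) \<and>
     (\<forall>x\<in>X. \<forall>y\<in>X. d x y = d y x) \<and>
     (\<exists>K\<ge>1. \<forall>x\<in>X. \<forall>y\<in>X. \<forall>z\<in>X. d x y \<le> K * (d x z + d z y))"

definition qball :: "'a set \<Rightarrow> ('a \<Rightarrow> 'a \<Rightarrow> real) \<Rightarrow> 'a \<Rightarrow> real \<Rightarrow> 'a set" where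
  "qball X d x r = {y \<in> X. d x y < r}"

definition qtopology :: "'a set \<Rightarrow> ('a \<Rightarrow> 'a \<Rightarrow> real) \<Rightarrow> 'a topology" where
  "qtopology X d = topology (\<lambda>U. U \<subseteq> X \<and> (\<forall>x\<in>U. \<exists>r>0. qball X d x r \<subseteq> U))"

lemma openin_qtopology:
  "openin (qtopology X d) U \<longleftrightarrow> U \<subseteq> X \<and> (\<forall>x\<in>U. \<exists>r>0. qball X d x r \<subseteq> U)"
proof -
  have inter: "\<exists>r>0. qball X d x r \<subseteq> S \<inter> T"
    if "\<exists>r>0. qball X d x r \<subseteq> S" "\<exists>r>0. qball X d x r \<subseteq> T" for x S T
  proof -
    from that obtain r s where "r > 0" "qball X d x r \<subseteq> S" "s > 0" "qball X d x s \<subseteq> T"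
      by blast
    then have "min r s > 0 \<and> qball X d x (min r s) \<subseteq> S \<inter> T"
      by (auto simp: qball_def)
    then show ?thesis by blast
  qed
  have "istopology (\<lambda>U. U \<subseteq> X \<and> (\<forall>x\<in>U. \<exists>r>0. qball X d x r \<subseteq> U))"
    unfolding istopology_def
  proof (intro conjI allI impI)
    fix S T
    assume "S \<subseteq> X \<and> (\<forall>x\<in>S. \<exists>r>0. qball X d x r \<subseteq> S)"
      and "T \<subseteq> X \<and> (\<forall>x\<in>T. \<exists>r>0. qball X d x r \<subseteq> T)"
    then show "S \<inter> T \<subseteq> X" and "\<forall>x\<in>S \<inter> T. \<exists>r>0. qball X d x r \<subseteq> S \<inter> T"
      using inter by auto
  next
    fix \<U>
    assume "\<forall>U\<in>\<U>. U \<subseteq> X \<and> (\<forall>x\<in>U. \<exists>r>0. qball X d x r \<subseteq> U)"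
    then show "\<Union>\<U> \<subseteq> X" and "\<forall>x\<in>\<Union>\<U>. \<exists>r>0. qball X d x r \<subseteq> \<Union>\<U>"
      by (blast, meson Union_iff Union_upper order_trans)
  qed
  then show ?thesis
    by (simp add: qtopology_def topology_inverse')
qed

definition qdiam :: "('a \<Rightarrow> 'a \<Rightarrow> real) \<Rightarrow> 'a set \<Rightarrow> ennreal" where
  "qdiam d G = (SUP x\<in>G. SUP y\<in>G. ennreal (d x y))"

definition borel_measure_on :: "'a topology \<Rightarrow> 'a measure \<Rightarrow> bool" where
  "borel_measure_on T \<mu> \<longleftrightarrow>
     space \<mu> = topspace T \<and> sets \<mu> = sigma_sets (topspace T) {U. openin T U}"

definition doubling :: "'a set \<Rightarrow> ('a \<Rightarrow> 'a \<Rightarrow> real) \<Rightarrow> 'a measure \<Rightarrow> bool" where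
  "doubling X d \<mu> \<longleftrightarrow>
     (\<exists>A::real. A \<ge> 1 \<and> (\<forall>x\<in>X. \<forall>r>0.
        0 < emeasure \<mu> (qball X d x (2 * r)) \<and>
        emeasure \<mu> (qball X d x (2 * r)) \<le> ennreal A * emeasure \<mu> (qball X d x r) \<and>
        ennreal A * emeasure \<mu> (qball X d x r) < \<infinity>))"

definition non_atomic :: "'a set \<Rightarrow> 'a measure \<Rightarrow> bool" where
  "non_atomic X \<mu> \<longleftrightarrow> (\<forall>x\<in>X. emeasure \<mu> {x} = 0)"

text \<open>
  Balls of a quasi-metric need not be open in the induced topology, so their openness (and hence
  their measurability) is a separate requirement.
\<close>

definition homogeneous_type :: "'a set \<Rightarrow> ('a \<Rightarrow> 'a \<Rightarrow> real) \<Rightarrow> 'a measure \<Rightarrow> bool" where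
  "homogeneous_type X d \<mu> \<longleftrightarrow>
     quasi_metric_on X d \<and>
     (\<forall>x\<in>X. \<forall>r>0. openin (qtopology X d) (qball X d x r)) \<and>
     borel_measure_on (qtopology X d) \<mu> \<and>
     doubling X d \<mu> \<and>
     non_atomic X \<mu>"

end

theory Submission
  imports Defs
begin

text \<open>
  Give each \<open>x \<in> G\<close> the largest dyadic fraction \<open>R x\<close> of a fixed radius exceeding the
  diameter of \<open>G\<close> for which \<open>\<mu> (B(x, R x)) < \<rho>\<close>; by doubling, this measure is
  then comparable to \<open>\<rho>\<close>. Choose centres greedily, always taking an uncovered point whose radius
  is as large as possible. Any two centres satisfy \<open>d s t \<ge> max (R s) (R t)\<close>, so the balls
  \<open>B(s, R s / (2 K))\<close> are disjoint. All of them have measure at least a fixed multiple of \<open>\<rho>\<close>.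
  Those lying in one ball of finite measure are therefore finitely many, so the selection stops, and
  those with \<open>y \<in> B(s, R s)\<close> lie in one ball of measure at most a fixed multiple of \<open>\<rho>\<close>,
  which bounds the overlap.
\<close>

locale doubling_quasi_metric =
  fixes X :: "'a set" and d :: "'a \<Rightarrow> 'a \<Rightarrow> real" and \<mu> :: "'a measure" and K A :: real
  assumes nonneg: "\<And>x y. x \<in> X \<Longrightarrow> y \<in> X \<Longrightarrow> 0 \<le> d x y"
    and zero_iff: "\<And>x y. x \<in> X \<Longrightarrow> y \<in> X \<Longrightarrow> d x y = 0 \<longleftrightarrow> x = y"
    and commute: "\<And>x y. x \<in> X \<Longrightarrow> y \<in> X \<Longrightarrow> d x y = d y x"
    and K_ge_1: "1 \<le> K"
    and triangle: "\<And>x y z. x \<in> X \<Longrightarrow> y \<in> X \<Longrightarrow> z \<in> X \<Longrightarrow> d x y \<le> K * (d x z + d z y)"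
    and A_ge_1: "1 \<le> A"
    and ball_sets: "\<And>x r. x \<in> X \<Longrightarrow> 0 < r \<Longrightarrow> qball X d x r \<in> sets \<mu>"
    and ball_finite: "\<And>x r. x \<in> X \<Longrightarrow> 0 < r \<Longrightarrow> emeasure \<mu> (qball X d x r) < \<infinity>"
    and ball_doubling: "\<And>x r. x \<in> X \<Longrightarrow> 0 < r \<Longrightarrow>
      measure \<mu> (qball X d x (2 * r)) \<le> A * measure \<mu> (qball X d x r)"
    and null_singleton: "\<And>x. x \<in> X \<Longrightarrow> emeasure \<mu> {x} = 0"
begin

lemma ball_fmeasurable: "x \<in> X \<Longrightarrow> 0 < r \<Longrightarrow> qball X d x r \<in> fmeasurable \<mu>"
  using ball_sets ball_finite by (simp add: fmeasurable_def)

lemma ball_mono: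
  assumes "x \<in> X" "0 < r" "r \<le> s"
  shows "measure \<mu> (qball X d x r) \<le> measure \<mu> (qball X d x s)"
  using assms ball_sets ball_fmeasurable
  by (intro measure_mono_fmeasurable) (auto simp: qball_def)

lemma ball_doubling_power:
  assumes "x \<in> X" "0 < r"
  shows "measure \<mu> (qball X d x (2 ^ n * r)) \<le> A ^ n * measure \<mu> (qball X d x r)"
proof (induction n)
  case (Suc n)
  have "measure \<mu> (qball X d x (2 ^ Suc n * r)) \<le> A * measure \<mu> (qball X d x (2 ^ n * r))"
    using ball_doubling[of x "2 ^ n * r"] assms by (simp add: mult.assoc)
  also have "\<dots> \<le> A * (A ^ n * measure \<mu> (qball X d x r))"
    using Suc A_ge_1 by (intro mult_left_mono) auto
  finally show ?case by (simp add: mult.assoc)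
qed simp

lemma small_dyadic_ball:
  assumes x: "x \<in> X" and r: "0 < r" and \<rho>: "0 < \<rho>"
  shows "\<exists>n. measure \<mu> (qball X d x (r / 2 ^ n)) < \<rho>"
proof -
  let ?B = "\<lambda>n. qball X d x (r / 2 ^ n)"
  have pos: "0 < r / 2 ^ n" for n :: nat
    using r by simp
  have dec: "decseq ?B"
  proof (rule decseq_SucI)
    show "?B (Suc n) \<subseteq> ?B n" for n
      using pos[of n] by (auto simp: qball_def field_simps)
  qed
  have Int: "(\<Inter>n. ?B n) = {x}"
  proof (intro equalityI subsetI)
    fix y assume y: "y \<in> (\<Inter>n. ?B n)"
    then have yX: "y \<in> X" by (auto simp: qball_def)
    have "(\<lambda>n. r / 2 ^ n) \<longlonglongrightarrow> 0"
      using LIMSEQ_divide_realpow_zero[of 2 r] by simp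
    moreover have "d x y \<le> r / 2 ^ n" for n
      using y by (auto simp: qball_def less_imp_le)
    ultimately have "d x y \<le> 0"
      by (intro LIMSEQ_le_const) auto
    then show "y \<in> {x}"
      using nonneg[OF x yX] zero_iff[OF x yX] by simp
  next
    fix y assume "y \<in> {x}"
    then show "y \<in> (\<Inter>n. ?B n)"
      using x zero_iff[OF x x] pos by (auto simp: qball_def)
  qed
  have "(\<lambda>n. measure \<mu> (?B n)) \<longlonglongrightarrow> measure \<mu> (\<Inter>n. ?B n)"
    using ball_sets[OF x pos] ball_finite[OF x pos] dec
    by (intro Lim_measure_decseq) (auto simp: less_top[symmetric] image_subset_iff)
  then have "(\<lambda>n. measure \<mu> (?B n)) \<longlonglongrightarrow> 0"
    using null_singleton[OF x] by (simp only: Int) (simp add: measure_def)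
  then have "\<forall>\<^sub>F n in sequentially. measure \<mu> (?B n) < \<rho>"
    using \<rho> by (rule order_tendstoD)
  then show ?thesis
    by (auto simp: eventually_sequentially)
qed

lemma card_le_packing:
  assumes "finite S" "S \<subseteq> X" "z \<in> X" "0 < t" "\<And>s. s \<in> S \<Longrightarrow> 0 < R s"
    and "disjoint_family_on (\<lambda>s. qball X d s (R s)) S"
    and "\<And>s. s \<in> S \<Longrightarrow> qball X d s (R s) \<subseteq> qball X d z t"
    and "\<And>s. s \<in> S \<Longrightarrow> m \<le> measure \<mu> (qball X d s (R s))"
  shows "real (card S) * m \<le> measure \<mu> (qball X d z t)"
proof -
  have meas: "qball X d s (R s) \<in> sets \<mu>" if "s \<in> S" for s
    using that assms ball_sets by blast
  have "real (card S) * m \<le> (\<Sum>s\<in>S. measure \<mu> (qball X d s (R s)))"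
    using assms(8) by (rule sum_bounded_below)
  also have "\<dots> = measure \<mu> (\<Union>s\<in>S. qball X d s (R s))"
    using assms meas ball_finite
    by (intro measure_finite_Union[symmetric]) (fastforce simp: less_top[symmetric])+
  also have "\<dots> \<le> measure \<mu> (qball X d z t)"
    using assms meas ball_fmeasurable
    by (intro measure_mono_fmeasurable sets.finite_UN) blast+
  finally show ?thesis .
qed

lemma disjoint_separated_balls:
  assumes "S \<subseteq> X" "\<And>s t. s \<in> S \<Longrightarrow> t \<in> S \<Longrightarrow> s \<noteq> t \<Longrightarrow> max (R s) (R t) \<le> d s t"
  shows "disjoint_family_on (\<lambda>s. qball X d s (R s / (2 * K))) S"
  unfolding disjoint_family_on_def
proof (intro ballI impI equals0I)
  fix s t y
  assume st: "s \<in> S" "t \<in> S" "s \<noteq> t"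
    and "y \<in> qball X d s (R s / (2 * K)) \<inter> qball X d t (R t / (2 * K))"
  then have y: "y \<in> X" "d s y < R s / (2 * K)" "d t y < R t / (2 * K)"
    by (auto simp: qball_def)
  have "d s t \<le> K * (d s y + d y t)"
    using st y assms by (intro triangle) auto
  also have "\<dots> < K * (R s / (2 * K) + R t / (2 * K))"
    using y st assms(1) K_ge_1 commute[of y t] by (intro mult_strict_left_mono) auto
  also have "\<dots> = (R s + R t) / 2"
    using K_ge_1 by (simp add: field_simps)
  also have "\<dots> \<le> max (R s) (R t)"
    by simp
  finally show False
    using assms(2)[OF st] by simp
qed

lemma greedy_selection:
  fixes n :: "'a \<Rightarrow> nat" and R :: "'a \<Rightarrow> real"
  assumes "G \<subseteq> X" and R_pos: "\<And>x. x \<in> G \<Longrightarrow> 0 < R x"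
    and R_anti: "\<And>x y. n x \<le> n y \<Longrightarrow> R y \<le> R x"
    and bdd: "\<And>S. finite S \<Longrightarrow> S \<subseteq> G \<Longrightarrow>
      (\<And>s t. s \<in> S \<Longrightarrow> t \<in> S \<Longrightarrow> s \<noteq> t \<Longrightarrow> max (R s) (R t) \<le> d s t) \<Longrightarrow> card S \<le> N"
  obtains S where "finite S" "S \<subseteq> G" "G \<subseteq> (\<Union>s\<in>S. qball X d s (R s))"
    "\<And>s t. s \<in> S \<Longrightarrow> t \<in> S \<Longrightarrow> s \<noteq> t \<Longrightarrow> max (R s) (R t) \<le> d s t"
proof -
  define U where "U S = G - (\<Union>s\<in>S. qball X d s (R s))" for S
  define good where "good S \<longleftrightarrow> finite S \<and> S \<subseteq> G \<and>
      (\<forall>s\<in>S. \<forall>t\<in>S. s \<noteq> t \<longrightarrow> max (R s) (R t) \<le> d s t) \<and> (\<forall>s\<in>S. \<forall>x\<in>U S. R x \<le> R s)" for S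
  have "good {}"
    by (simp add: good_def)
  moreover have "\<forall>S. good S \<longrightarrow> card S \<le> N"
    using bdd by (simp add: good_def)
  ultimately obtain S where S: "good S" and max: "\<And>T. good T \<Longrightarrow> card T \<le> card S"
    using ex_has_greatest_nat[of good "{}" card "Suc N"] by (auto simp: less_Suc_eq_le)
  have "U S = {}"
  proof (rule ccontr)
    assume "U S \<noteq> {}"
    then obtain x\<^sub>0 where "x\<^sub>0 \<in> U S" by blast
    then obtain x where x: "x \<in> U S" and least: "\<And>y. y \<in> U S \<Longrightarrow> n x \<le> n y"
      using ex_has_least_nat[of "\<lambda>x. x \<in> U S" x\<^sub>0 n] by blast
    have xG: "x \<in> G" "x \<in> X"
      using x assms(1) by (auto simp: U_def)
    have far: "R s \<le> d s x" if "s \<in> S" for s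
      using x xG that by (force simp: U_def qball_def)
    have "x \<notin> S"
      using far[of x] zero_iff[of x x] R_pos[of x] xG by auto
    have "good (insert x S)"
    proof -
      have "max (R s) (R x) \<le> d s x" "max (R x) (R s) \<le> d x s" if "s \<in> S" for s
      proof -
        have "R x \<le> R s" "d x s = d s x"
          using S x xG that assms(1) commute[of x s] by (auto simp: good_def)
        then show "max (R s) (R x) \<le> d s x" "max (R x) (R s) \<le> d x s"
          using far[OF that] by auto
      qed
      moreover have "R y \<le> R x" "\<And>s. s \<in> S \<Longrightarrow> R y \<le> R s" if "y \<in> U (insert x S)" for y
      proof -
        have "y \<in> U S"
          using that by (auto simp: U_def)
        then show "R y \<le> R x" "\<And>s. s \<in> S \<Longrightarrow> R y \<le> R s"
          using S R_anti[OF least] by (auto simp: good_def)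
      qed
      ultimately show ?thesis
        using S xG unfolding good_def by simp
    qed
    then show False
      using max[of "insert x S"] S \<open>x \<notin> S\<close> by (simp add: good_def)
  qed
  then show ?thesis
    using S that[of S] by (auto simp: good_def U_def)
qed

lemma bounded_overlap_cover:
  assumes G: "G \<subseteq> X" and D: "0 \<le> D" "\<And>x y. x \<in> G \<Longrightarrow> y \<in> G \<Longrightarrow> d x y \<le> D" and \<rho>: "0 < \<rho>"
    and p: "3 * K\<^sup>2 \<le> 2 ^ p" and q: "4 * K \<le> 2 ^ q"
  shows "\<exists>S R. finite S \<and> S \<subseteq> G \<and> (\<forall>s\<in>S. 0 < R s \<and> measure \<mu> (qball X d s (R s)) < \<rho>) \<and>
    G \<subseteq> (\<Union>s\<in>S. qball X d s (R s)) \<and>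
    (\<forall>y\<in>X. real (card {s\<in>S. y \<in> qball X d s (R s)}) \<le> A ^ (p + q))"
proof (cases "\<exists>x\<in>G. measure \<mu> (qball X d x (D + 1)) < \<rho>")
  case True
  then obtain x where x: "x \<in> G" "measure \<mu> (qball X d x (D + 1)) < \<rho>" by blast
  have "real (card {s\<in>{x}. y \<in> qball X d s (D + 1)}) \<le> A ^ (p + q)" for y
  proof -
    have "card {s\<in>{x}. y \<in> qball X d s (D + 1)} \<le> card {x}"
      by (intro card_mono) auto
    then show ?thesis
      using one_le_power[OF A_ge_1, of "p + q"] by simp
  qed
  moreover have "G \<subseteq> qball X d x (D + 1)"
    using G D(2)[OF x(1)] by (force simp: qball_def)
  ultimately show ?thesis
    using x D(1) by (intro exI[of _ "{x}"] exI[of _ "\<lambda>_. D + 1"]) auto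
next
  case False
  define small where "small x k \<longleftrightarrow> measure \<mu> (qball X d x ((D + 1) / 2 ^ k)) < \<rho>" for x and k :: nat
  define n where "n x = (LEAST k. small x k)" for x
  define R where "R x = (D + 1) / 2 ^ n x" for x
  define c where "c = 1 / (2 * K)"
  have R_pos: "0 < R x" for x
    using D by (simp add: R_def)
  have c: "0 < c" "c \<le> 1" "2 \<le> 2 ^ q * c"
    using K_ge_1 q by (auto simp: c_def field_simps)
  have R_anti: "R y \<le> R x" if "n x \<le> n y" for x y
    unfolding R_def using D that by (intro divide_left_mono) auto
  have R_le: "R x \<le> D + 1" for x
    using D mult_left_mono[of 1 "2 ^ n x" "D + 1"] by (simp add: R_def field_simps)
  have upper: "measure \<mu> (qball X d x (R x)) < \<rho>" if "x \<in> G" for x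
  proof -
    have "\<exists>k. small x k"
      using small_dyadic_ball[of x "D + 1" \<rho>] that G D \<rho> by (auto simp: small_def)
    then have "small x (n x)"
      unfolding n_def by (rule LeastI_ex)
    then show ?thesis by (simp add: small_def R_def)
  qed
  have lower: "\<rho> / A ^ q \<le> measure \<mu> (qball X d x (R x / (2 * K)))" if "x \<in> G" for x
  proof -
    have "n x \<noteq> 0"
      using upper[OF that] False that by (metis R_def div_by_1 power_0)
    then obtain k where k: "n x = Suc k"
      by (cases "n x") auto
    then have "\<not> small x k"
      using not_less_Least[of k "small x"] by (simp add: n_def)
    moreover have "2 * R x = (D + 1) / 2 ^ k"
      by (simp add: R_def k field_simps)
    ultimately have "\<rho> \<le> measure \<mu> (qball X d x (2 * R x))"
      by (simp add: small_def)
    also have "\<dots> \<le> measure \<mu> (qball X d x (2 ^ q * (c * R x)))"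
      using that G R_pos[of x] mult_right_mono[OF c(3), of "R x"]
      by (intro ball_mono) (auto simp: mult.assoc)
    also have "\<dots> \<le> A ^ q * measure \<mu> (qball X d x (c * R x))"
      using that G R_pos[of x] c by (intro ball_doubling_power) auto
    finally show ?thesis
      using A_ge_1 by (simp add: c_def field_simps)
  qed
  have cR_le: "R s / (2 * K) \<le> R s" for s
    using mult_right_mono[OF c(2), of "R s"] R_pos[of s] by (simp add: c_def)
  have packing: "real (card S) * (\<rho> / A ^ q) \<le> measure \<mu> (qball X d z t)"
    if "finite S" "S \<subseteq> G" "z \<in> X" "0 < t"
      and sep: "\<And>s t. s \<in> S \<Longrightarrow> t \<in> S \<Longrightarrow> s \<noteq> t \<Longrightarrow> max (R s) (R t) \<le> d s t"
      and near: "\<And>s. s \<in> S \<Longrightarrow> K * (R s + d s z) \<le> t" for S z t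
  proof (rule card_le_packing[where R = "\<lambda>s. R s / (2 * K)"])
    show "disjoint_family_on (\<lambda>s. qball X d s (R s / (2 * K))) S"
      using that G by (intro disjoint_separated_balls) auto
    show "qball X d s (R s / (2 * K)) \<subseteq> qball X d z t" if s: "s \<in> S" for s
    proof
      fix y assume y: "y \<in> qball X d s (R s / (2 * K))"
      then have yX: "y \<in> X" and sX: "s \<in> X" and dsy: "d s y < R s"
        using cR_le[of s] s \<open>S \<subseteq> G\<close> G by (auto simp: qball_def)
      have "d z y \<le> K * (d z s + d s y)"
        using yX sX \<open>z \<in> X\<close> by (intro triangle)
      also have "\<dots> < K * (R s + d s z)"
        using dsy K_ge_1 commute[OF sX \<open>z \<in> X\<close>] by (intro mult_strict_left_mono) auto
      also have "\<dots> \<le> t"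
        using near[OF s] .
      finally show "y \<in> qball X d z t"
        using yX by (simp add: qball_def)
    qed
  qed (use that G R_pos K_ge_1 lower in auto)
  obtain N where N: "\<And>S. finite S \<Longrightarrow> S \<subseteq> G \<Longrightarrow>
      (\<And>s t. s \<in> S \<Longrightarrow> t \<in> S \<Longrightarrow> s \<noteq> t \<Longrightarrow> max (R s) (R t) \<le> d s t) \<Longrightarrow> card S \<le> N"
  proof (cases "G = {}")
    case True
    then show ?thesis using that[of 0] by auto
  next
    case False
    then obtain z where z: "z \<in> G" by blast
    define M where "M = measure \<mu> (qball X d z (K * (D + 1 + D))) / (\<rho> / A ^ q)"
    show ?thesis
    proof (rule that)
      fix S assume S: "finite S" "S \<subseteq> G"
        and sep: "\<And>s t. s \<in> S \<Longrightarrow> t \<in> S \<Longrightarrow> s \<noteq> t \<Longrightarrow> max (R s) (R t) \<le> d s t"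
      have "real (card S) * (\<rho> / A ^ q) \<le> measure \<mu> (qball X d z (K * (D + 1 + D)))"
      proof (rule packing)
        show "K * (R s + d s z) \<le> K * (D + 1 + D)" if "s \<in> S" for s
          using that S z K_ge_1 R_le[of s] D(2)[of s z] by (intro mult_left_mono) auto
      qed (use S sep z G D K_ge_1 in auto)
      then have "real (card S) \<le> M"
        using \<rho> A_ge_1 by (simp add: M_def field_simps)
      then show "card S \<le> nat \<lfloor>M\<rfloor>"
        by (simp add: le_nat_floor)
    qed
  qed
  obtain S where S: "finite S" "S \<subseteq> G" "G \<subseteq> (\<Union>s\<in>S. qball X d s (R s))"
    and sep: "\<And>s t. s \<in> S \<Longrightarrow> t \<in> S \<Longrightarrow> s \<noteq> t \<Longrightarrow> max (R s) (R t) \<le> d s t"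
    using greedy_selection[of G R n N] G R_pos R_anti N by blast
  have "real (card {s\<in>S. y \<in> qball X d s (R s)}) \<le> A ^ (p + q)" if y: "y \<in> X" for y
  proof (cases "{s\<in>S. y \<in> qball X d s (R s)} = {}")
    case True
    show ?thesis unfolding True using A_ge_1 by simp
  next
    case False
    let ?J = "{s\<in>S. y \<in> qball X d s (R s)}"
    obtain z\<^sub>0 where "z\<^sub>0 \<in> ?J" using False by blast
    then obtain z where z: "z \<in> ?J" and z_least: "\<And>s. s \<in> ?J \<Longrightarrow> n z \<le> n s"
      using ex_has_least_nat[of "\<lambda>s. s \<in> ?J" z\<^sub>0 n] by blast
    have z_max: "R s \<le> R z" if "s \<in> ?J" for s
      using z_least[OF that] by (rule R_anti)
    have zX: "z \<in> X" "z \<in> G"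
      using z S G by auto
    have "real (card ?J) * (\<rho> / A ^ q) \<le> measure \<mu> (qball X d z (2 ^ p * R z))"
    proof (rule packing)
      fix s assume s: "s \<in> ?J"
      then have sX: "s \<in> X" using S G by auto
      have "d s z \<le> K * (d s y + d y z)"
        using sX zX y by (intro triangle)
      also have "\<dots> \<le> K * (R z + R z)"
        using s z z_max[OF s] K_ge_1 commute[OF y zX(1)]
        by (intro mult_left_mono) (auto simp: qball_def)
      finally have "d s z \<le> 2 * (K * R z)" by simp
      moreover have "R s \<le> K * R z"
        using z_max[OF s] mult_right_mono[OF K_ge_1, of "R z"] R_pos[of z] by linarith
      ultimately have "K * (R s + d s z) \<le> K * (3 * (K * R z))"
        using K_ge_1 by (intro mult_left_mono) auto
      also have "\<dots> = 3 * K\<^sup>2 * R z"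
        by (simp add: power2_eq_square)
      also have "\<dots> \<le> 2 ^ p * R z"
        using p R_pos[of z] by (intro mult_right_mono) auto
      finally show "K * (R s + d s z) \<le> 2 ^ p * R z" .
    qed (use S sep zX R_pos in auto)
    also have "\<dots> \<le> A ^ p * measure \<mu> (qball X d z (R z))"
      using zX R_pos by (intro ball_doubling_power)
    also have "\<dots> \<le> A ^ p * \<rho>"
      using upper[OF zX(2)] A_ge_1 by (intro mult_left_mono) auto
    finally show ?thesis
      using \<rho> A_ge_1 by (simp add: power_add field_simps)
  qed
  then show ?thesis
    using S upper R_pos by (intro exI[of _ S] exI[of _ R]) blast
qed

end

lemma homogeneous_type_doubling_quasi_metric:
  assumes "homogeneous_type X d \<mu>"
  obtains K A where "doubling_quasi_metric X d \<mu> K A"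
proof -
  have qm: "quasi_metric_on X d"
    and op: "\<And>x r. x \<in> X \<Longrightarrow> 0 < r \<Longrightarrow> openin (qtopology X d) (qball X d x r)"
    and bm: "borel_measure_on (qtopology X d) \<mu>" and dbl: "doubling X d \<mu>"
    and na: "non_atomic X \<mu>"
    using assms by (auto simp: homogeneous_type_def)
  obtain K where K: "K \<ge> 1" "\<forall>x\<in>X. \<forall>y\<in>X. \<forall>z\<in>X. d x y \<le> K * (d x z + d z y)"
    using qm by (auto simp: quasi_metric_on_def)
  obtain A where A: "A \<ge> 1"
    and A_dbl: "\<And>x r. x \<in> X \<Longrightarrow> 0 < r \<Longrightarrow>
      emeasure \<mu> (qball X d x (2 * r)) \<le> ennreal A * emeasure \<mu> (qball X d x r)"
    and A_fin: "\<And>x r. x \<in> X \<Longrightarrow> 0 < r \<Longrightarrow> ennreal A * emeasure \<mu> (qball X d x r) < \<infinity>"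
    using dbl by (auto simp: doubling_def)
  have fin: "emeasure \<mu> (qball X d x r) < \<infinity>" if "x \<in> X" "0 < r" for x r
    using A_fin[OF that] A by (auto simp: ennreal_mult_less_top)
  have "doubling_quasi_metric X d \<mu> K A"
  proof
    show "qball X d x r \<in> sets \<mu>" if "x \<in> X" "0 < r" for x r
      using op[OF that] bm by (auto simp: borel_measure_on_def)
    show "measure \<mu> (qball X d x (2 * r)) \<le> A * measure \<mu> (qball X d x r)"
      if "x \<in> X" "0 < r" for x r
      using enn2real_mono[OF A_dbl[OF that]] A_fin[OF that] A
      by (simp add: measure_def enn2real_mult)
  qed (use qm K A fin na in \<open>auto simp: quasi_metric_on_def non_atomic_def\<close>)
  then show ?thesis by (rule that)
qed

theorem lemma3p1:
  fixes X :: "'a set" and d :: "'a \<Rightarrow> 'a \<Rightarrow> real" and \<mu> :: "'a measure"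
  assumes "homogeneous_type X d \<mu>"
  shows "\<exists>\<Lambda>::nat. \<forall>G \<rho>::real. G \<subseteq> X \<and> qdiam d G < \<infinity> \<and> \<rho> > 0 \<longrightarrow>
    (\<exists>(I::nat) (x::nat \<Rightarrow> 'a) (r::nat \<Rightarrow> real).
       (\<forall>i\<in>{1..I}. x i \<in> G \<and> r i > 0 \<and> emeasure \<mu> (qball X d (x i) (r i)) < ennreal \<rho>) \<and>
       G \<subseteq> (\<Union>i\<in>{1..I}. qball X d (x i) (r i)) \<and>
       (\<forall>y\<in>X. card {i\<in>{1..I}. y \<in> qball X d (x i) (r i)} \<le> \<Lambda>))"
proof -
  obtain K A where "doubling_quasi_metric X d \<mu> K A"
    using homogeneous_type_doubling_quasi_metric[OF assms] .
  then interpret doubling_quasi_metric X d \<mu> K A .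
  obtain p q :: nat where p: "3 * K\<^sup>2 \<le> 2 ^ p" and q: "4 * K \<le> 2 ^ q"
    using real_arch_pow[of 2] by (metis less_imp_le one_less_numeral_iff semiring_norm(76))
  show ?thesis
  proof (rule exI[of _ "nat \<lfloor>A ^ (p + q)\<rfloor>"], intro allI impI, elim conjE)
    fix G and \<rho> :: real
    assume G: "G \<subseteq> X" and diam: "qdiam d G < \<infinity>" and \<rho>: "0 < \<rho>"
    have "d x y \<le> enn2real (qdiam d G)" if "x \<in> G" "y \<in> G" for x y
    proof -
      have "ennreal (d x y) \<le> qdiam d G"
        unfolding qdiam_def using that by (meson SUP_upper2 SUP_upper)
      then have "enn2real (ennreal (d x y)) \<le> enn2real (qdiam d G)"
        using diam by (intro enn2real_mono) auto
      then show ?thesis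
        using that G nonneg[of x y] by (simp add: subset_iff)
    qed
    then obtain S R where S: "finite S" "S \<subseteq> G" "G \<subseteq> (\<Union>s\<in>S. qball X d s (R s))"
      and R: "\<And>s. s \<in> S \<Longrightarrow> 0 < R s" "\<And>s. s \<in> S \<Longrightarrow> measure \<mu> (qball X d s (R s)) < \<rho>"
      and overlap: "\<And>y. y \<in> X \<Longrightarrow> real (card {s\<in>S. y \<in> qball X d s (R s)}) \<le> A ^ (p + q)"
      using bounded_overlap_cover[OF G _ _ \<rho> p q, of "enn2real (qdiam d G)"] by auto
    obtain x where x: "bij_betw x {1..card S} S"
      using ex_bij_betw_nat_finite_1[OF S(1)] by blast
    have x_image: "x ` {1..card S} = S"
      using x by (rule bij_betw_imp_surj_on)
    have "\<forall>i\<in>{1..card S}. x i \<in> G \<and> R (x i) > 0 \<and> emeasure \<mu> (qball X d (x i) (R (x i))) < ennreal \<rho>"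
    proof
      fix i assume i: "i \<in> {1..card S}"
      have xi: "x i \<in> S" "x i \<in> X"
        using i x_image S(2) G by blast+
      have "emeasure \<mu> (qball X d (x i) (R (x i))) = ennreal (measure \<mu> (qball X d (x i) (R (x i))))"
        using ball_finite[OF xi(2) R(1)[OF xi(1)]] by (intro emeasure_eq_ennreal_measure) auto
      then show "x i \<in> G \<and> R (x i) > 0 \<and> emeasure \<mu> (qball X d (x i) (R (x i))) < ennreal \<rho>"
        using xi S R by (auto intro!: ennreal_lessI \<rho>)
    qed
    moreover have "G \<subseteq> (\<Union>i\<in>{1..card S}. qball X d (x i) (R (x i)))"
    proof
      fix y assume "y \<in> G"
      then obtain s where "s \<in> S" "y \<in> qball X d s (R s)"
        using S(3) by blast
      moreover obtain i where "i \<in> {1..card S}" "s = x i"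
        using \<open>s \<in> S\<close> x_image by blast
      ultimately show "y \<in> (\<Union>i\<in>{1..card S}. qball X d (x i) (R (x i)))"
        by blast
    qed
    moreover have "\<forall>y\<in>X. card {i\<in>{1..card S}. y \<in> qball X d (x i) (R (x i))} \<le> nat \<lfloor>A ^ (p + q)\<rfloor>"
    proof
      fix y assume y: "y \<in> X"
      have "card {i\<in>{1..card S}. y \<in> qball X d (x i) (R (x i))} \<le> card {s\<in>S. y \<in> qball X d s (R s)}"
      proof (rule card_inj_on_le)
        show "inj_on x {i\<in>{1..card S}. y \<in> qball X d (x i) (R (x i))}"
          using bij_betw_imp_inj_on[OF x] by (rule inj_on_subset) blast
        show "x ` {i\<in>{1..card S}. y \<in> qball X d (x i) (R (x i))} \<subseteq> {s\<in>S. y \<in> qball X d s (R s)}"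
          using x_image by blast
        show "finite {s\<in>S. y \<in> qball X d s (R s)}"
          using S(1) by simp
      qed
      also have "\<dots> \<le> nat \<lfloor>A ^ (p + q)\<rfloor>"
        using overlap[OF y] by (rule le_nat_floor)
      finally show "card {i\<in>{1..card S}. y \<in> qball X d (x i) (R (x i))} \<le> nat \<lfloor>A ^ (p + q)\<rfloor>" .
    qed
    ultimately show "\<exists>(I::nat) x r.
       (\<forall>i\<in>{1..I}. x i \<in> G \<and> r i > 0 \<and> emeasure \<mu> (qball X d (x i) (r i)) < ennreal \<rho>) \<and>
       G \<subseteq> (\<Union>i\<in>{1..I}. qball X d (x i) (r i)) \<and>
       (\<forall>y\<in>X. card {i\<in>{1..I}. y \<in> qball X d (x i) (r i)} \<le> nat \<lfloor>A ^ (p + q)\<rfloor>)"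
      by (intro exI[of _ "card S"] exI[of _ x] exI[of _ "\<lambda>i. R (x i)"] conjI)
  qed
qed

end
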